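(* Let $(A,\mathbf{C}^t_A)$ be a tangled closure algebra with induced closure operator $\mathbf{C}_A$ and interior operator $\mathbf{I}_A$, and let $\alpha\in A$ be open, i.e. $\mathbf{I}_A\alpha=\alpha$. Then the relativisation $(A_\alpha,\mathbf{C}^t_\alpha)$ is a tangled closure algebra whose induced closure operator is $\mathbf{C}_\alpha$.
   Context: A Boolean algebra $A$ has operations $\land,\lor,-,0,1$; $a\Rightarrow b=-a\lor b$. A closure operator on $A$ is $\mathbf{C}:A\to A$ with $\mathbf{C}(a\lor b)=\mathbf{C}a\lor\mathbf{C}b$, $\mathbf{C}0=0$, $a\leq\mathbf{C}a=\mathbf{C}\mathbf{C}a$; interior $\mathbf{I}a=-\mathbf{C}-a$. $\mathcal{P}_{fin}A$ is the set of finite non-empty subsets of $A$. For $\mathbf{C}^t:\mathcal{P}_{fin}A\to A$, the induced $\mathbf{C}a=\mathbf{C}^t\{a\}$, $\mathbf{I}a=-\mathbf{C}^t\{-a\}$; $(A,\mathbf{C}^t)$ is a tangled closure algebra if $\mathbf{C}$ is a closure operator and for all $\varGamma\in\mathcal{P}_{fin}A$, $a\in A$: (Fix) $\mathbf{C}^t\varGamma\leq\bigwedge_{\gamma\in\varGamma}\mathbf{C}(\gamma\land\mathbf{C}^t\varGamma)$; (Ind) $\mathbf{I}(a\Rightarrow\bigwedge_{\gamma\in\varGamma}\mathbf{C}(\gamma\land a))\land a\leq\mathbf{C}^t\varGamma$. Relativisation: for $\alpha\in A$, $A_\alpha=\{b\in A:b\leq\alpha\}$ is the Boolean algebra with the same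 joins and meets as $A$, top $\alpha$, and complement $b\mapsto\alpha\land-b$ (so its implication is $b\Rightarrow_\alpha c=(\alpha\land-b)\lor c$); $\mathbf{C}_\alpha b=\alpha\land\mathbf{C}_Ab$ for $b\in A_\alpha$; and $\mathbf{C}^t_\alpha\varGamma=\alpha\land\mathbf{C}^t_A\varGamma$ for finite non-empty $\varGamma\subseteq A_\alpha$. *)

theory Defs
  imports "HOL-Algebra.FiniteProduct"
begin

text \<open>
  Boolean algebras are taken with an explicit carrier and explicit operations, because the
  relativisation to the elements below a fixed element lives on a subset of the same type and has
  a different top and complement. All operations are only meaningful on the carrier.
\<close>

record 'a bool_alg = "'a partial_object" +
  bmeet :: "'a \<Rightarrow> 'a \<Rightarrow> 'a" (infixl \<open>\<^bold>\<and>\<index>\<close> 70)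
  bjoin :: "'a \<Rightarrow> 'a \<Rightarrow> 'a" (infixl \<open>\<^bold>\<or>\<index>\<close> 65)
  bcompl :: "'a \<Rightarrow> 'a" (\<open>\<^bold>-\<index> _\<close> [81] 80)
  bzero :: 'a (\<open>\<^bold>0\<index>\<close>)
  bone :: 'a (\<open>\<^bold>1\<index>\<close>)

locale bool_algebra =
  fixes A (structure)
  assumes meet_closed: "\<lbrakk>a \<in> carrier A; b \<in> carrier A\<rbrakk> \<Longrightarrow> a \<^bold>\<and> b \<in> carrier A"
    and join_closed: "\<lbrakk>a \<in> carrier A; b \<in> carrier A\<rbrakk> \<Longrightarrow> a \<^bold>\<or> b \<in> carrier A"
    and compl_closed: "a \<in> carrier A \<Longrightarrow> \<^bold>- a \<in> carrier A"
    and zero_closed: "\<^bold>0 \<in> carrier A"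
    and one_closed: "\<^bold>1 \<in> carrier A"
    and meet_assoc: "\<lbrakk>a \<in> carrier A; b \<in> carrier A; c \<in> carrier A\<rbrakk> \<Longrightarrow> (a \<^bold>\<and> b) \<^bold>\<and> c = a \<^bold>\<and> (b \<^bold>\<and> c)"
    and join_assoc: "\<lbrakk>a \<in> carrier A; b \<in> carrier A; c \<in> carrier A\<rbrakk> \<Longrightarrow> (a \<^bold>\<or> b) \<^bold>\<or> c = a \<^bold>\<or> (b \<^bold>\<or> c)"
    and meet_comm: "\<lbrakk>a \<in> carrier A; b \<in> carrier A\<rbrakk> \<Longrightarrow> a \<^bold>\<and> b = b \<^bold>\<and> a"
    and join_comm: "\<lbrakk>a \<in> carrier A; b \<in> carrier A\<rbrakk> \<Longrightarrow> a \<^bold>\<or> b = b \<^bold>\<or> a"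
    and meet_absorb: "\<lbrakk>a \<in> carrier A; b \<in> carrier A\<rbrakk> \<Longrightarrow> a \<^bold>\<and> (a \<^bold>\<or> b) = a"
    and join_absorb: "\<lbrakk>a \<in> carrier A; b \<in> carrier A\<rbrakk> \<Longrightarrow> a \<^bold>\<or> (a \<^bold>\<and> b) = a"
    and meet_join_distrib:
      "\<lbrakk>a \<in> carrier A; b \<in> carrier A; c \<in> carrier A\<rbrakk> \<Longrightarrow> a \<^bold>\<and> (b \<^bold>\<or> c) = (a \<^bold>\<and> b) \<^bold>\<or> (a \<^bold>\<and> c)"
    and join_meet_distrib:
      "\<lbrakk>a \<in> carrier A; b \<in> carrier A; c \<in> carrier A\<rbrakk> \<Longrightarrow> a \<^bold>\<or> (b \<^bold>\<and> c) = (a \<^bold>\<or> b) \<^bold>\<and> (a \<^bold>\<or> c)"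
    and meet_one: "a \<in> carrier A \<Longrightarrow> a \<^bold>\<and> \<^bold>1 = a"
    and join_zero: "a \<in> carrier A \<Longrightarrow> a \<^bold>\<or> \<^bold>0 = a"
    and meet_compl: "a \<in> carrier A \<Longrightarrow> a \<^bold>\<and> \<^bold>- a = \<^bold>0"
    and join_compl: "a \<in> carrier A \<Longrightarrow> a \<^bold>\<or> \<^bold>- a = \<^bold>1"

definition bleq :: "('a, 'm) bool_alg_scheme \<Rightarrow> 'a \<Rightarrow> 'a \<Rightarrow> bool" (infix \<open>\<^bold>\<le>\<index>\<close> 50)
  where "a \<^bold>\<le>\<^bsub>A\<^esub> b \<longleftrightarrow> a \<^bold>\<and>\<^bsub>A\<^esub> b = a"

definition bimp :: "('a, 'm) bool_alg_scheme \<Rightarrow> 'a \<Rightarrow> 'a \<Rightarrow> 'a" (infixr \<open>\<^bold>\<Rightarrow>\<index>\<close> 60)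
  where "a \<^bold>\<Rightarrow>\<^bsub>A\<^esub> b = (\<^bold>-\<^bsub>A\<^esub> a) \<^bold>\<or>\<^bsub>A\<^esub> b"

definition bMeet :: "('a, 'm) bool_alg_scheme \<Rightarrow> ('b \<Rightarrow> 'a) \<Rightarrow> 'b set \<Rightarrow> 'a"
  where "bMeet A f \<Gamma> = finprod \<lparr>carrier = carrier A, mult = bmeet A, one = bone A\<rparr> f \<Gamma>"

definition Pfin :: "'a set \<Rightarrow> 'a set set"
  where "Pfin X = {\<Gamma>. \<Gamma> \<subseteq> X \<and> finite \<Gamma> \<and> \<Gamma> \<noteq> {}}"

locale closure_operator = bool_algebra A for A (structure) +
  fixes C :: "'a \<Rightarrow> 'a"
  assumes C_closed: "a \<in> carrier A \<Longrightarrow> C a \<in> carrier A"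
    and C_join: "\<lbrakk>a \<in> carrier A; b \<in> carrier A\<rbrakk> \<Longrightarrow> C (a \<^bold>\<or> b) = C a \<^bold>\<or> C b"
    and C_zero: "C \<^bold>0 = \<^bold>0"
    and C_extensive: "a \<in> carrier A \<Longrightarrow> a \<^bold>\<le> C a"
    and C_idem: "a \<in> carrier A \<Longrightarrow> C a = C (C a)"

definition induced_closure :: "('a set \<Rightarrow> 'a) \<Rightarrow> 'a \<Rightarrow> 'a"
  where "induced_closure Ct a = Ct {a}"

definition induced_interior :: "('a, 'm) bool_alg_scheme \<Rightarrow> ('a set \<Rightarrow> 'a) \<Rightarrow> 'a \<Rightarrow> 'a"
  where "induced_interior A Ct a = \<^bold>-\<^bsub>A\<^esub> (Ct {\<^bold>-\<^bsub>A\<^esub> a})"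

locale tangled_closure_algebra =
  bool_algebra A + closure_operator A "induced_closure Ct"
  for A (structure) and Ct :: "'a set \<Rightarrow> 'a" +
  assumes Ct_closed: "\<Gamma> \<in> Pfin (carrier A) \<Longrightarrow> Ct \<Gamma> \<in> carrier A"
    and Fix: "\<Gamma> \<in> Pfin (carrier A) \<Longrightarrow>
      Ct \<Gamma> \<^bold>\<le> bMeet A (\<lambda>\<gamma>. induced_closure Ct (\<gamma> \<^bold>\<and> Ct \<Gamma>)) \<Gamma>"
    and Ind: "\<lbrakk>\<Gamma> \<in> Pfin (carrier A); a \<in> carrier A\<rbrakk> \<Longrightarrow>
      induced_interior A Ct (a \<^bold>\<Rightarrow> bMeet A (\<lambda>\<gamma>. induced_closure Ct (\<gamma> \<^bold>\<and> a)) \<Gamma>) \<^bold>\<and> a \<^bold>\<le> Ct \<Gamma>"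

definition rel_alg :: "'a bool_alg \<Rightarrow> 'a \<Rightarrow> 'a bool_alg"
  where "rel_alg A \<alpha> = \<lparr>carrier = {b \<in> carrier A. b \<^bold>\<le>\<^bsub>A\<^esub> \<alpha>},
    bmeet = bmeet A, bjoin = bjoin A, bcompl = (\<lambda>b. \<alpha> \<^bold>\<and>\<^bsub>A\<^esub> \<^bold>-\<^bsub>A\<^esub> b),
    bzero = \<^bold>0\<^bsub>A\<^esub>, bone = \<alpha>\<rparr>"

definition rel_closure :: "'a bool_alg \<Rightarrow> ('a \<Rightarrow> 'a) \<Rightarrow> 'a \<Rightarrow> 'a \<Rightarrow> 'a"
  where "rel_closure A C \<alpha> b = \<alpha> \<^bold>\<and>\<^bsub>A\<^esub> C b"

definition rel_tangle :: "'a bool_alg \<Rightarrow> ('a set \<Rightarrow> 'a) \<Rightarrow> 'a \<Rightarrow> 'a set \<Rightarrow> 'a"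
  where "rel_tangle A Ct \<alpha> \<Gamma> = \<alpha> \<^bold>\<and>\<^bsub>A\<^esub> Ct \<Gamma>"

end

theory Submission
  imports Defs
begin

text \<open>
  If \<open>\<alpha>\<close> is open, then \<open>-\<alpha>\<close> is closed, so splitting \<open>C b = C (b \<and> \<alpha>) \<or> C (b \<and> -\<alpha>)\<close> and using
  \<open>C (b \<and> -\<alpha>) \<le> -\<alpha>\<close> gives \<open>\<alpha> \<and> C b \<le> C (\<alpha> \<and> b)\<close>. This transfers (Fix) to the relativisation and
  shows that the interior operator of the relativisation is \<open>\<alpha> \<and> I b\<close>, which reduces (Ind) for
  the relativisation to (Ind) for the whole algebra by monotonicity of the interior.
\<close>

section \<open>Order, residuation, complements and finite meets in a Boolean algebra\<close>

context bool_algebra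
begin

lemma le_trans:
  assumes "a \<^bold>\<le> b" "b \<^bold>\<le> c" "a \<in> carrier A" "b \<in> carrier A" "c \<in> carrier A"
  shows "a \<^bold>\<le> c"
  using assms by (metis bleq_def meet_assoc)

lemma le_antisym:
  "\<lbrakk>a \<^bold>\<le> b; b \<^bold>\<le> a; a \<in> carrier A; b \<in> carrier A\<rbrakk> \<Longrightarrow> a = b"
  by (metis bleq_def meet_comm)

text \<open>The two absorption laws combine to a = a \<and> (a \<or> (a \<and> a)) = a \<and>
  a.\<close>

lemma meet_idem: "a \<in> carrier A \<Longrightarrow> a \<^bold>\<and> a = a"
  by (metis join_absorb meet_absorb meet_closed)

lemma le_refl: "a \<in> carrier A \<Longrightarrow> a \<^bold>\<le> a"
  by (simp add: bleq_def meet_idem)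

lemma meet_le1: "\<lbrakk>a \<in> carrier A; b \<in> carrier A\<rbrakk> \<Longrightarrow> a \<^bold>\<and> b \<^bold>\<le> a"
  unfolding bleq_def by (metis meet_assoc meet_comm meet_idem)

lemma meet_le2: "\<lbrakk>a \<in> carrier A; b \<in> carrier A\<rbrakk> \<Longrightarrow> a \<^bold>\<and> b \<^bold>\<le> b"
  by (metis meet_le1 meet_comm)

lemma le_meet_iff:
  assumes "x \<in> carrier A" "a \<in> carrier A" "b \<in> carrier A"
  shows "x \<^bold>\<le> a \<^bold>\<and> b \<longleftrightarrow> x \<^bold>\<le> a \<and> x \<^bold>\<le> b"
proof
  assume "x \<^bold>\<le> a \<^bold>\<and> b"
  then show "x \<^bold>\<le> a \<and> x \<^bold>\<le> b"
    using assms by (meson le_trans meet_le1 meet_le2 meet_closed)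
next
  assume "x \<^bold>\<le> a \<and> x \<^bold>\<le> b"
  then show "x \<^bold>\<le> a \<^bold>\<and> b"
    using assms by (metis bleq_def meet_assoc)
qed

text \<open>Absorption makes the order read off from meets agree with the one read off from joins.
  The join form is what lets additivity of a closure operator yield its monotonicity.\<close>

lemma le_iff_join:
  "\<lbrakk>a \<in> carrier A; b \<in> carrier A\<rbrakk> \<Longrightarrow> a \<^bold>\<le> b \<longleftrightarrow> a \<^bold>\<or> b = b"
  unfolding bleq_def by (metis join_absorb join_comm meet_absorb meet_comm)

lemma join_ge1: "\<lbrakk>a \<in> carrier A; b \<in> carrier A\<rbrakk> \<Longrightarrow> a \<^bold>\<le> a \<^bold>\<or> b"
  by (simp add: bleq_def meet_absorb)

lemma join_ge2: "\<lbrakk>a \<in> carrier A; b \<in> carrier A\<rbrakk> \<Longrightarrow> b \<^bold>\<le> a \<^bold>\<or> b"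
  by (metis join_ge1 join_comm)

lemma join_le_iff:
  assumes "x \<in> carrier A" "a \<in> carrier A" "b \<in> carrier A"
  shows "a \<^bold>\<or> b \<^bold>\<le> x \<longleftrightarrow> a \<^bold>\<le> x \<and> b \<^bold>\<le> x"
proof
  assume "a \<^bold>\<or> b \<^bold>\<le> x"
  then show "a \<^bold>\<le> x \<and> b \<^bold>\<le> x"
    using assms by (meson le_trans join_ge1 join_ge2 join_closed)
next
  assume "a \<^bold>\<le> x \<and> b \<^bold>\<le> x"
  then show "a \<^bold>\<or> b \<^bold>\<le> x"
    using assms by (metis le_iff_join join_assoc join_closed)
qed

lemma zero_le: "a \<in> carrier A \<Longrightarrow> \<^bold>0 \<^bold>\<le> a"
  by (metis join_comm join_zero le_iff_join zero_closed)

lemma le_one: "a \<in> carrier A \<Longrightarrow> a \<^bold>\<le> \<^bold>1"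
  by (simp add: bleq_def meet_one)

lemma meet_le_iff_le_join:
  assumes [simp]: "a \<in> carrier A" "b \<in> carrier A" "c \<in> carrier A"
  shows "a \<^bold>\<and> b \<^bold>\<le> c \<longleftrightarrow> a \<^bold>\<le> \<^bold>- b \<^bold>\<or> c"
proof
  note [simp] = meet_closed join_closed compl_closed
  assume *: "a \<^bold>\<and> b \<^bold>\<le> c"
  have "a = a \<^bold>\<and> (\<^bold>- b \<^bold>\<or> b)"
    by (metis assms(1,2) compl_closed join_comm join_compl meet_one)
  also have "\<dots> = (a \<^bold>\<and> \<^bold>- b) \<^bold>\<or> (a \<^bold>\<and> b)"
    by (simp add: meet_join_distrib)
  also have "\<dots> \<^bold>\<le> \<^bold>- b \<^bold>\<or> c"
    using * by (simp add: join_le_iff)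
      (meson assms compl_closed join_closed join_ge1 join_ge2 le_trans meet_closed meet_le2)
  finally show "a \<^bold>\<le> \<^bold>- b \<^bold>\<or> c" .
next
  note [simp] = meet_closed join_closed compl_closed
  assume *: "a \<^bold>\<le> \<^bold>- b \<^bold>\<or> c"
  have "a \<^bold>\<and> b \<^bold>\<le> b \<^bold>\<and> (\<^bold>- b \<^bold>\<or> c)"
    using * by (simp add: le_meet_iff meet_le2)
      (meson assms compl_closed join_closed le_trans meet_closed meet_le1)
  also have "b \<^bold>\<and> (\<^bold>- b \<^bold>\<or> c) = \<^bold>0 \<^bold>\<or> (b \<^bold>\<and> c)"
    by (simp add: meet_join_distrib meet_compl)
  also have "\<dots> = b \<^bold>\<and> c"
    by (metis assms(2,3) join_comm join_zero meet_closed zero_closed)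
  finally show "a \<^bold>\<and> b \<^bold>\<le> c"
    by (meson assms le_trans meet_closed meet_le2)
qed

text \<open>The case c = 0 of residuation. It turns bounds by complements into vanishing meets,
  which can be regrouped freely.\<close>

lemma le_compl_iff:
  assumes "a \<in> carrier A" "b \<in> carrier A"
  shows "a \<^bold>\<le> \<^bold>- b \<longleftrightarrow> a \<^bold>\<and> b = \<^bold>0"
  using assms meet_le_iff_le_join[of a b "\<^bold>0"]
  by (metis compl_closed join_zero le_antisym le_refl meet_closed zero_closed zero_le)

text \<open>Meeting the double complement with a \<or> -a leaves only its meet with a, since it is
  disjoint from -a. The other inequality is disjointness of a and -a.\<close>

lemma compl_compl:
  assumes "a \<in> carrier A"
  shows "\<^bold>- (\<^bold>- a) = a"
proof (rule le_antisym)
  show "\<^bold>- (\<^bold>- a) \<^bold>\<le> a"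
  proof -
    have "\<^bold>- (\<^bold>- a) = \<^bold>- (\<^bold>- a) \<^bold>\<and> (a \<^bold>\<or> \<^bold>- a)"
      using assms by (simp add: join_compl meet_one compl_closed)
    also have "\<dots> = \<^bold>- (\<^bold>- a) \<^bold>\<and> a"
      using assms
      by (simp add: meet_join_distrib compl_closed meet_closed join_zero meet_compl
          meet_comm[of "\<^bold>- (\<^bold>- a)" "\<^bold>- a"])
    finally show ?thesis
      by (simp add: bleq_def)
  qed
  show "a \<^bold>\<le> \<^bold>- (\<^bold>- a)"
    using assms by (simp add: le_compl_iff compl_closed meet_compl)
qed (use assms compl_closed in auto)

lemma compl_antimono:
  assumes "a \<^bold>\<le> b" "a \<in> carrier A" "b \<in> carrier A"
  shows "\<^bold>- b \<^bold>\<le> \<^bold>- a"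
proof -
  have "a \<^bold>\<le> \<^bold>- (\<^bold>- b)"
    using assms by (simp add: compl_compl)
  then show ?thesis
    using assms by (metis compl_closed le_compl_iff meet_comm)
qed

lemma meet_comm_monoid:
  "comm_monoid \<lparr>carrier = carrier A, mult = bmeet A, one = bone A\<rparr>"
  by (rule comm_monoidI)
    (auto simp: meet_closed one_closed meet_assoc meet_one meet_comm[OF one_closed]
      intro: meet_comm)

text \<open>Induction on the index set identifies the monoid product with the infimum, the empty
  product being the top. Being available in every Boolean algebra, this serves both A and its
  relativisation, whose finite meets are products in different monoids.\<close>

lemma
  assumes "finite \<Gamma>" "f \<in> \<Gamma> \<rightarrow> carrier A"
  shows bMeet_closed: "bMeet A f \<Gamma> \<in> carrier A"
    and le_bMeet_iff:
      "x \<in> carrier A \<Longrightarrow> x \<^bold>\<le> bMeet A f \<Gamma> \<longleftrightarrow> (\<forall>\<gamma>\<in>\<Gamma>. x \<^bold>\<le> f \<gamma>)"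
proof -
  interpret M: comm_monoid "\<lparr>carrier = carrier A, mult = bmeet A, one = bone A\<rparr>"
    by (rule meet_comm_monoid)
  have *: "bMeet A f \<Gamma> \<in> carrier A \<and>
      (\<forall>x \<in> carrier A. x \<^bold>\<le> bMeet A f \<Gamma> \<longleftrightarrow> (\<forall>\<gamma>\<in>\<Gamma>. x \<^bold>\<le> f \<gamma>))"
    using assms
  proof (induction \<Gamma> rule: finite_induct)
    case empty
    show ?case by (simp add: bMeet_def one_closed le_one)
  next
    case (insert \<gamma> \<Gamma>)
    then have "bMeet A f (insert \<gamma> \<Gamma>) = f \<gamma> \<^bold>\<and> bMeet A f \<Gamma>"
      unfolding bMeet_def by (subst M.finprod_insert) auto
    with insert show ?case
      by (auto simp: le_meet_iff meet_closed Pi_iff)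
  qed
  show "bMeet A f \<Gamma> \<in> carrier A"
    using * by blast
  show "x \<in> carrier A \<Longrightarrow> x \<^bold>\<le> bMeet A f \<Gamma> \<longleftrightarrow> (\<forall>\<gamma>\<in>\<Gamma>. x \<^bold>\<le> f \<gamma>)"
    using * by blast
qed

end

section \<open>Closure operators and open elements\<close>

context closure_operator
begin

lemma C_mono:
  "\<lbrakk>a \<^bold>\<le> b; a \<in> carrier A; b \<in> carrier A\<rbrakk> \<Longrightarrow> C a \<^bold>\<le> C b"
  by (metis C_closed C_join le_iff_join)

lemma open_meet_C_le:
  assumes \<alpha>: "\<alpha> \<in> carrier A" "\<^bold>- C (\<^bold>- \<alpha>) = \<alpha>" and b: "b \<in> carrier A"
  shows "\<alpha> \<^bold>\<and> C b \<^bold>\<le> C (\<alpha> \<^bold>\<and> b)"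
proof -
  note [simp] = meet_closed join_closed compl_closed C_closed \<alpha>(1) b
  have closed: "C (\<^bold>- \<alpha>) = \<^bold>- \<alpha>"
    using \<alpha> by (metis C_closed compl_closed compl_compl)
  \<comment> \<open>The splitting of b along \<alpha> is done by residuation: \<alpha> is moved to
    the right as its complement, \<open>C\<close> is applied to both sides and fixes that
    complement, and \<alpha> is moved back.\<close>
  have "b \<^bold>\<and> \<alpha> \<^bold>\<le> \<alpha> \<^bold>\<and> b"
    by (simp add: meet_comm[of b \<alpha>] le_refl)
  then have "b \<^bold>\<le> \<^bold>- \<alpha> \<^bold>\<or> (\<alpha> \<^bold>\<and> b)"
    by (simp add: meet_le_iff_le_join)
  then have "C b \<^bold>\<le> \<^bold>- \<alpha> \<^bold>\<or> C (\<alpha> \<^bold>\<and> b)"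
    using C_mono[of b "\<^bold>- \<alpha> \<^bold>\<or> (\<alpha> \<^bold>\<and> b)"] by (simp add: C_join closed)
  then have "C b \<^bold>\<and> \<alpha> \<^bold>\<le> C (\<alpha> \<^bold>\<and> b)"
    by (simp add: meet_le_iff_le_join)
  then show ?thesis
    by (simp add: meet_comm[of \<alpha>])
qed

end

section \<open>The Boolean algebra of elements below \<alpha>\<close>

lemma rel_alg_simps [simp]:
  "carrier (rel_alg A \<alpha>) = {b \<in> carrier A. b \<^bold>\<le>\<^bsub>A\<^esub> \<alpha>}"
  "bmeet (rel_alg A \<alpha>) = bmeet A"
  "bjoin (rel_alg A \<alpha>) = bjoin A"
  "bcompl (rel_alg A \<alpha>) = (\<lambda>b. \<alpha> \<^bold>\<and>\<^bsub>A\<^esub> \<^bold>-\<^bsub>A\<^esub> b)"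
  "bzero (rel_alg A \<alpha>) = \<^bold>0\<^bsub>A\<^esub>"
  "bone (rel_alg A \<alpha>) = \<alpha>"
  "bleq (rel_alg A \<alpha>) = bleq A"
  \<comment> \<open>The order is defined from the meet alone, which is shared, so every inequality
    in the relativisation becomes one in A.\<close>
  by (auto simp: rel_alg_def bleq_def fun_eq_iff)

text \<open>Identities in meet, join and zero are inherited from A. The new content is that the
  operations stay below \<alpha> and that the new top and complement obey their laws.\<close>

lemma bool_algebra_rel_alg:
  assumes "bool_algebra A" and \<alpha> [simp]: "\<alpha> \<in> carrier A"
  shows "bool_algebra (rel_alg A \<alpha>)"
proof -
  interpret bool_algebra A by fact
  note [simp] = meet_closed join_closed compl_closed zero_closed
  show ?thesis
  \<comment> \<open>Goals follow the order of the axioms of \<open>bool_algebra\<close>: 1 is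
    closure under meet, 12 and 13 are distributivity, 14 is the law for the top, 16 and 17 are the
    complement laws.\<close>
  proof (unfold_locales, goal_cases)
    case (1 a b)
    then show ?case by simp (meson \<alpha> le_trans meet_closed meet_le1)
  next
    case (16 a)
    then have [simp]: "a \<in> carrier A" by simp
    have "a \<^bold>\<and>\<^bsub>A\<^esub> (\<alpha> \<^bold>\<and>\<^bsub>A\<^esub> \<^bold>-\<^bsub>A\<^esub> a) = \<alpha> \<^bold>\<and>\<^bsub>A\<^esub> (a \<^bold>\<and>\<^bsub>A\<^esub> \<^bold>-\<^bsub>A\<^esub> a)"
      by (metis \<open>a \<in> carrier A\<close> \<alpha> compl_closed meet_assoc meet_comm)
    also have "\<dots> = \<^bold>0\<^bsub>A\<^esub>"
      using zero_le[of \<alpha>] by (simp add: meet_compl bleq_def meet_comm[of \<alpha>])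
    finally show ?case by simp
  next
    case (17 a)
    then have "a \<in> carrier A" "a \<^bold>\<or>\<^bsub>A\<^esub> \<alpha> = \<alpha>"
      using le_iff_join[of a \<alpha>] by auto
    \<comment> \<open>By distributivity a \<or> (\<alpha> \<and> -a) = (a \<or> \<alpha>) \<and> (a
      \<or> -a), which is \<alpha> \<and> 1.\<close>
    then show ?case
      by (simp add: join_meet_distrib join_compl meet_one)
  next
    case (12 a b c)
    then show ?case by (simp add: meet_join_distrib)
  next
    case (13 a b c)
    then show ?case by (simp add: join_meet_distrib)
  next
    case (14 a)
    then show ?case by (simp add: bleq_def)
  qed (auto simp: meet_assoc join_assoc meet_absorb join_absorb join_zero join_le_iff meet_le1
      zero_le le_refl intro: meet_comm join_comm)
qed

section \<open>The tangled closure on the relativisation\<close>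

theorem theorem3p3:
  fixes A :: "'a bool_alg" and Ct :: "'a set \<Rightarrow> 'a" and \<alpha> :: 'a
  assumes "tangled_closure_algebra A Ct"
    and "\<alpha> \<in> carrier A"
    and "induced_interior A Ct \<alpha> = \<alpha>"
  shows "tangled_closure_algebra (rel_alg A \<alpha>) (rel_tangle A Ct \<alpha>) \<and>
    (\<forall>b \<in> carrier (rel_alg A \<alpha>).
      induced_closure (rel_tangle A Ct \<alpha>) b = rel_closure A (induced_closure Ct) \<alpha> b)"
proof
  interpret tangled_closure_algebra A Ct by fact
  interpret R: bool_algebra "rel_alg A \<alpha>"
    using bool_algebra_axioms assms(2) by (rule bool_algebra_rel_alg)
  \<comment> \<open>Interpreting the closure laws for the short name \<open>C\<close> states them in
    the form that the goals take after rewriting with \<open>Cr\<close>.\<close>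
  define C where "C = induced_closure Ct"
  have C: "closure_operator A C"
    unfolding C_def by unfold_locales
  interpret C: closure_operator A C
    by (fact C)
  have Cr: "induced_closure (rel_tangle A Ct \<alpha>) = (\<lambda>b. \<alpha> \<^bold>\<and>\<^bsub>A\<^esub> C b)"
    by (simp add: fun_eq_iff induced_closure_def rel_tangle_def C_def)
  show "\<forall>b \<in> carrier (rel_alg A \<alpha>).
      induced_closure (rel_tangle A Ct \<alpha>) b = rel_closure A (induced_closure Ct) \<alpha> b"
    by (simp add: Cr rel_closure_def C_def)
  note \<alpha> [simp] = assms(2)
  note [simp] = meet_closed join_closed compl_closed zero_closed C.C_closed Ct_closed
  have I: "induced_interior A Ct x = \<^bold>-\<^bsub>A\<^esub> C (\<^bold>-\<^bsub>A\<^esub> x)" for x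
    by (simp add: induced_interior_def C_def induced_closure_def)
  have opn: "\<^bold>-\<^bsub>A\<^esub> C (\<^bold>-\<^bsub>A\<^esub> \<alpha>) = \<alpha>"
    using assms(3) by (simp add: I)
  note relC = C.open_meet_C_le[OF \<alpha> opn]
  show "tangled_closure_algebra (rel_alg A \<alpha>) (rel_tangle A Ct \<alpha>)"
  \<comment> \<open>The Boolean laws come from \<open>R\<close>. Goals 1 to 5 are the closure
    operator axioms, 6 is closedness of the tangle, 7 is (Fix) and 8 is (Ind).\<close>
  proof (unfold_locales, unfold Cr, goal_cases)
    case (1 a)
    then show ?case by (simp add: meet_le1)
  next
    case (2 a b)
    then show ?case by (simp add: C.C_join meet_join_distrib)
  next
    case 3
    show ?case using zero_le[of \<alpha>] by (simp add: C.C_zero bleq_def meet_comm[of \<alpha>])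
  next
    case (4 a)
    then show ?case by (simp add: le_meet_iff C.C_extensive)
  next
    case (5 a)
    then have [simp]: "a \<in> carrier A" by simp
    show ?case
    proof (rule le_antisym)
      show "\<alpha> \<^bold>\<and>\<^bsub>A\<^esub> C a \<^bold>\<le>\<^bsub>A\<^esub> \<alpha> \<^bold>\<and>\<^bsub>A\<^esub> C (\<alpha> \<^bold>\<and>\<^bsub>A\<^esub> C a)"
        by (simp add: le_meet_iff C.C_extensive meet_le1)
      have "C (\<alpha> \<^bold>\<and>\<^bsub>A\<^esub> C a) \<^bold>\<le>\<^bsub>A\<^esub> C a"
        using C.C_mono[of "\<alpha> \<^bold>\<and>\<^bsub>A\<^esub> C a" "C a"] by (simp add: meet_le2 C.C_idem[symmetric])
      then show "\<alpha> \<^bold>\<and>\<^bsub>A\<^esub> C (\<alpha> \<^bold>\<and>\<^bsub>A\<^esub> C a) \<^bold>\<le>\<^bsub>A\<^esub> \<alpha> \<^bold>\<and>\<^bsub>A\<^esub> C a"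
        using le_trans[OF meet_le2, of \<alpha> "C (\<alpha> \<^bold>\<and>\<^bsub>A\<^esub> C a)" "C a"]
        by (simp add: le_meet_iff meet_le1)
    qed simp_all
  next
    case (6 \<Gamma>)
    then have "\<Gamma> \<in> Pfin (carrier A)" by (auto simp: Pfin_def)
    then show ?case by (simp add: rel_tangle_def meet_le1)
  next
    case (7 \<Gamma>)
    then have \<Gamma>: "\<Gamma> \<in> Pfin (carrier A)" and fin: "finite \<Gamma>" and sub: "\<Gamma> \<subseteq> carrier A"
      by (auto simp: Pfin_def)
    define t where "t = Ct \<Gamma>"
    have t [simp]: "t \<in> carrier A" using \<Gamma> by (simp add: t_def)
    \<comment> \<open>(Fix) is checked one \<gamma> at a time. Meeting (Fix) of A with \<alpha> and
      pulling \<alpha> inside the closure by \<open>relC\<close> gives \<alpha> \<and> (\<gamma>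
      \<and> t), which regroups so that the relativised tangle \<alpha> \<and> t appears.\<close>
    have "\<alpha> \<^bold>\<and>\<^bsub>A\<^esub> t \<^bold>\<le>\<^bsub>A\<^esub> \<alpha> \<^bold>\<and>\<^bsub>A\<^esub> C (\<gamma> \<^bold>\<and>\<^bsub>A\<^esub> (\<alpha> \<^bold>\<and>\<^bsub>A\<^esub> t))" if "\<gamma> \<in> \<Gamma>" for \<gamma>
    proof -
      have \<gamma> [simp]: "\<gamma> \<in> carrier A" using that sub by auto
      have "t \<^bold>\<le>\<^bsub>A\<^esub> bMeet A (\<lambda>\<gamma>. C (\<gamma> \<^bold>\<and>\<^bsub>A\<^esub> t)) \<Gamma>"
        using Fix[OF \<Gamma>] by (simp add: C_def t_def)
      then have "t \<^bold>\<le>\<^bsub>A\<^esub> C (\<gamma> \<^bold>\<and>\<^bsub>A\<^esub> t)"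
        using that sub by (subst (asm) le_bMeet_iff[OF fin]) auto
      then have "\<alpha> \<^bold>\<and>\<^bsub>A\<^esub> t \<^bold>\<le>\<^bsub>A\<^esub> \<alpha> \<^bold>\<and>\<^bsub>A\<^esub> C (\<gamma> \<^bold>\<and>\<^bsub>A\<^esub> t)"
        using le_trans[OF meet_le2, of \<alpha> t "C (\<gamma> \<^bold>\<and>\<^bsub>A\<^esub> t)"] by (simp add: le_meet_iff meet_le1)
      then have "\<alpha> \<^bold>\<and>\<^bsub>A\<^esub> t \<^bold>\<le>\<^bsub>A\<^esub> C (\<alpha> \<^bold>\<and>\<^bsub>A\<^esub> (\<gamma> \<^bold>\<and>\<^bsub>A\<^esub> t))"
        using le_trans relC[of "\<gamma> \<^bold>\<and>\<^bsub>A\<^esub> t"] by simp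
      moreover have "\<alpha> \<^bold>\<and>\<^bsub>A\<^esub> (\<gamma> \<^bold>\<and>\<^bsub>A\<^esub> t) = \<gamma> \<^bold>\<and>\<^bsub>A\<^esub> (\<alpha> \<^bold>\<and>\<^bsub>A\<^esub> t)"
        by (metis \<alpha> \<gamma> t meet_assoc meet_comm)
      ultimately show ?thesis
        by (simp add: le_meet_iff meet_le1)
    qed
    then show ?case
      using sub
      by (subst R.le_bMeet_iff[OF fin]) (auto simp: rel_tangle_def t_def[symmetric] meet_le1)
  next
    case (8 \<Gamma> a)
    then have \<Gamma>: "\<Gamma> \<in> Pfin (carrier A)" and fin: "finite \<Gamma>" and sub: "\<Gamma> \<subseteq> carrier A"
      and a [simp]: "a \<in> carrier A" and a\<alpha>: "a \<^bold>\<le>\<^bsub>A\<^esub> \<alpha>"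
      by (auto simp: Pfin_def)
    \<comment> \<open>\<open>m\<close> and \<open>n\<close> are the finite meets in (Ind) for A and
      for the relativisation. Each factor of \<open>n\<close> is the matching factor of
      \<open>m\<close> cut down by \<alpha>, whence n \<le> m.\<close>
    define m where "m = bMeet A (\<lambda>\<gamma>. C (\<gamma> \<^bold>\<and>\<^bsub>A\<^esub> a)) \<Gamma>"
    define n where "n = bMeet (rel_alg A \<alpha>) (\<lambda>\<gamma>. \<alpha> \<^bold>\<and>\<^bsub>A\<^esub> C (\<gamma> \<^bold>\<and>\<^bsub>A\<^esub> a)) \<Gamma>"
    have m [simp]: "m \<in> carrier A"
      unfolding m_def using fin sub by (intro bMeet_closed) auto
    have n_rel: "n \<in> carrier (rel_alg A \<alpha>)"
      unfolding n_def using fin sub by (intro R.bMeet_closed) (auto simp: meet_le1)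
    then have n [simp]: "n \<in> carrier A" by simp
    have "n \<^bold>\<le>\<^bsub>A\<^esub> \<alpha> \<^bold>\<and>\<^bsub>A\<^esub> C (\<gamma> \<^bold>\<and>\<^bsub>A\<^esub> a)" if "\<gamma> \<in> \<Gamma>" for \<gamma>
    proof -
      have "(\<lambda>\<gamma>. \<alpha> \<^bold>\<and>\<^bsub>A\<^esub> C (\<gamma> \<^bold>\<and>\<^bsub>A\<^esub> a)) \<in> \<Gamma> \<rightarrow> carrier (rel_alg A \<alpha>)"
        using sub by (auto simp: meet_le1)
      from R.le_bMeet_iff[OF fin this n_rel] show ?thesis
        using that R.le_refl[OF n_rel] by (simp add: n_def[symmetric])
    qed
    then have "n \<^bold>\<le>\<^bsub>A\<^esub> C (\<gamma> \<^bold>\<and>\<^bsub>A\<^esub> a)" if "\<gamma> \<in> \<Gamma>" for \<gamma>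
      using that sub by (auto simp: le_meet_iff subset_iff)
    then have nm: "n \<^bold>\<le>\<^bsub>A\<^esub> m"
      unfolding m_def using sub by (subst le_bMeet_iff[OF fin]) auto
    \<comment> \<open>\<open>x\<close> is the relative implication from \<open>a\<close> to
      \<open>n\<close>, and \<open>y\<close> is the implication from \<open>a\<close> to
      \<open>m\<close> in A.\<close>
    define x where "x = (\<alpha> \<^bold>\<and>\<^bsub>A\<^esub> \<^bold>-\<^bsub>A\<^esub> a) \<^bold>\<or>\<^bsub>A\<^esub> n"
    define y where "y = \<^bold>-\<^bsub>A\<^esub> a \<^bold>\<or>\<^bsub>A\<^esub> m"
    have x [simp]: "x \<in> carrier A" and y [simp]: "y \<in> carrier A"
      by (simp_all add: x_def y_def)
    have "x \<^bold>\<le>\<^bsub>A\<^esub> y"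
      unfolding x_def y_def using nm
      by (simp add: join_le_iff)
        (meson \<alpha> a m n compl_closed join_closed join_ge1 join_ge2 le_trans meet_closed meet_le2)
    then have Cyx: "C (\<^bold>-\<^bsub>A\<^esub> y) \<^bold>\<le>\<^bsub>A\<^esub> C (\<^bold>-\<^bsub>A\<^esub> x)"
      by (simp add: C.C_mono compl_antimono)
    \<comment> \<open>\<open>z\<close> is the relative closure of the relative complement of
      \<open>x\<close>, so its own relative complement, later named \<open>w\<close>, is the
      relative interior of \<open>x\<close>.\<close>
    define z where "z = \<alpha> \<^bold>\<and>\<^bsub>A\<^esub> C (\<alpha> \<^bold>\<and>\<^bsub>A\<^esub> \<^bold>-\<^bsub>A\<^esub> x)"
    have z [simp]: "z \<in> carrier A" by (simp add: z_def)
    have "\<alpha> \<^bold>\<and>\<^bsub>A\<^esub> C (\<^bold>-\<^bsub>A\<^esub> y) \<^bold>\<le>\<^bsub>A\<^esub> \<alpha> \<^bold>\<and>\<^bsub>A\<^esub> C (\<^bold>-\<^bsub>A\<^esub> x)"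
      using Cyx le_trans[OF meet_le2, of \<alpha> "C (\<^bold>-\<^bsub>A\<^esub> y)" "C (\<^bold>-\<^bsub>A\<^esub> x)"]
      by (simp add: le_meet_iff meet_le1)
    \<comment> \<open>Openness of \<alpha> enters here: \<open>relC\<close> replaces the complement
      of \<open>x\<close> in A by its relative complement under the closure.\<close>
    moreover have "\<alpha> \<^bold>\<and>\<^bsub>A\<^esub> C (\<^bold>-\<^bsub>A\<^esub> x) \<^bold>\<le>\<^bsub>A\<^esub> z"
      using relC[of "\<^bold>-\<^bsub>A\<^esub> x"] by (simp add: z_def le_meet_iff meet_le1)
    ultimately have "\<alpha> \<^bold>\<and>\<^bsub>A\<^esub> C (\<^bold>-\<^bsub>A\<^esub> y) \<^bold>\<le>\<^bsub>A\<^esub> z"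
      using le_trans by simp
    \<comment> \<open>Contraposition relative to \<alpha>: the bound says that three elements have
      meet 0, and regrouping them puts the relative interior of \<open>x\<close> below the interior
      of \<open>y\<close> in A.\<close>
    then have "(\<alpha> \<^bold>\<and>\<^bsub>A\<^esub> C (\<^bold>-\<^bsub>A\<^esub> y)) \<^bold>\<and>\<^bsub>A\<^esub> \<^bold>-\<^bsub>A\<^esub> z = \<^bold>0\<^bsub>A\<^esub>"
      by (simp add: le_compl_iff[symmetric] compl_compl)
    then have "(\<alpha> \<^bold>\<and>\<^bsub>A\<^esub> \<^bold>-\<^bsub>A\<^esub> z) \<^bold>\<and>\<^bsub>A\<^esub> C (\<^bold>-\<^bsub>A\<^esub> y) = \<^bold>0\<^bsub>A\<^esub>"
      by (simp add: meet_assoc meet_comm[of "\<^bold>-\<^bsub>A\<^esub> z"])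
    then have "\<alpha> \<^bold>\<and>\<^bsub>A\<^esub> \<^bold>-\<^bsub>A\<^esub> z \<^bold>\<le>\<^bsub>A\<^esub> \<^bold>-\<^bsub>A\<^esub> C (\<^bold>-\<^bsub>A\<^esub> y)"
      by (simp add: le_compl_iff)
    moreover define w where "w = \<alpha> \<^bold>\<and>\<^bsub>A\<^esub> \<^bold>-\<^bsub>A\<^esub> z"
    ultimately have w: "w \<^bold>\<le>\<^bsub>A\<^esub> \<^bold>-\<^bsub>A\<^esub> C (\<^bold>-\<^bsub>A\<^esub> y)" and [simp]: "w \<in> carrier A"
      by simp_all
    have "w \<^bold>\<and>\<^bsub>A\<^esub> a \<^bold>\<le>\<^bsub>A\<^esub> \<^bold>-\<^bsub>A\<^esub> C (\<^bold>-\<^bsub>A\<^esub> y) \<^bold>\<and>\<^bsub>A\<^esub> a"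
      using w le_trans[OF meet_le1, of w a "\<^bold>-\<^bsub>A\<^esub> C (\<^bold>-\<^bsub>A\<^esub> y)"] by (simp add: le_meet_iff meet_le2)
    \<comment> \<open>This is (Ind) of A for \<open>a\<close>, its interior term being that of
      \<open>y\<close>. With a \<le> \<alpha> it bounds w \<and> a by the relativised
      tangle.\<close>
    moreover have "\<^bold>-\<^bsub>A\<^esub> C (\<^bold>-\<^bsub>A\<^esub> y) \<^bold>\<and>\<^bsub>A\<^esub> a \<^bold>\<le>\<^bsub>A\<^esub> Ct \<Gamma>"
      using Ind[OF \<Gamma> a] by (simp add: I bimp_def C_def[symmetric] m_def[symmetric] y_def)
    ultimately have "w \<^bold>\<and>\<^bsub>A\<^esub> a \<^bold>\<le>\<^bsub>A\<^esub> Ct \<Gamma>"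
      using le_trans \<Gamma> by simp
    moreover have "w \<^bold>\<and>\<^bsub>A\<^esub> a \<^bold>\<le>\<^bsub>A\<^esub> \<alpha>"
      using le_trans[OF meet_le2 a\<alpha>, of w] by simp
    ultimately have "w \<^bold>\<and>\<^bsub>A\<^esub> a \<^bold>\<le>\<^bsub>A\<^esub> \<alpha> \<^bold>\<and>\<^bsub>A\<^esub> Ct \<Gamma>"
      using \<Gamma> by (simp add: le_meet_iff)
    moreover have "induced_interior (rel_alg A \<alpha>) (rel_tangle A Ct \<alpha>) x = w"
      by (simp add: induced_interior_def rel_tangle_def C_def induced_closure_def w_def z_def)
    ultimately show ?case
      by (simp add: bimp_def n_def[symmetric] x_def[symmetric] rel_tangle_def)
  qed
qed

end
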